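(* Let $t \in \mathbb{N}$ and let $f(t)$ be an integer such that every graph not containing $K_t$ as a minor is $f(t)$-colorable. Then every graph not containing $K_t$ as an odd minor is $2f(t)$-colorable.
   Context: All graphs are finite, simple and undirected. A graph is $k$-colorable if it admits a proper vertex coloring with at most $k$ colors. Given $t \in \mathbb{N}$, a $K_t$-expansion is a graph consisting of $t$ pairwise vertex-disjoint (non-empty) trees $T_1,\ldots,T_t$ together with exactly one connecting edge between $T_s$ and $T_{s'}$ for every pair of distinct $s,s' \in \{1,\ldots,t\}$ (and no other vertices or edges). A graph contains $K_t$ as a minor if it has a subgraph (not necessarily induced) that is a $K_t$-expansion. A $K_t$-expansion $H$ certified by vertex-disjoint trees $T_1,\ldots,T_t$ is odd if there is an assignment of the two colors $\{1,2\}$ to the vertices of $H$ such that every edge contained in one of the trees $T_s$ is bichromatic (its endpoints have different colors), while every edge joining two distinct trees is monochromatic (its endpoints have the same color). A graph contains $K_t$ as an odd minor if it has a subgraph (not necessarily induced) that is an odd $K_t$-expansion. *)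

theory Defs
  imports "Graph_Theory.Pair_Digraph" "Graph_Theory.Digraph_Component"
begin

text \<open>
  A finite simple undirected graph is a \<^locale>\<open>pair_graph\<close>: a finite, loop-free, symmetric set of
  arcs, so the undirected edge \<open>uv\<close> is represented by the two arcs \<open>(u, v)\<close> and \<open>(v, u)\<close>.

  The library's \<^const>\<open>tree\<close> and \<^const>\<open>forest\<close> are not usable here, because the closed walk
  \<open>u, v, u\<close> along an edge counts as a \<^const>\<open>pre_digraph.cycle\<close>. The cycles with at least
  three arcs are exactly the cycles of the undirected graph. Non-emptiness is part of
  \<^const>\<open>connected\<close>.
\<close>

definition undirected_tree :: "'a pair_pre_digraph \<Rightarrow> bool" where
  "undirected_tree G \<longleftrightarrow>
     pair_graph G \<and> connected (with_proj G) \<and>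
     \<not> (\<exists>p. pre_digraph.cycle (with_proj G) p \<and> 3 \<le> length p)"

text \<open>
  Each undirected edge of \<open>H\<close> between \<open>T s\<close> and \<open>T s'\<close> contributes exactly one arc from
  \<open>T s\<close> to \<open>T s'\<close>, so the last clause says that there is exactly one connecting edge.
\<close>

definition clique_expansion ::
    "nat \<Rightarrow> (nat \<Rightarrow> 'a pair_pre_digraph) \<Rightarrow> 'a pair_pre_digraph \<Rightarrow> bool" where
  "clique_expansion t T H \<longleftrightarrow>
     pair_graph H \<and>
     (\<forall>s\<in>{1..t}. undirected_tree (T s)) \<and>
     (\<forall>s\<in>{1..t}. \<forall>s'\<in>{1..t}. s \<noteq> s' \<longrightarrow> pverts (T s) \<inter> pverts (T s') = {}) \<and>
     pverts H = (\<Union>s\<in>{1..t}. pverts (T s)) \<and>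
     (\<forall>s\<in>{1..t}. parcs H \<inter> (pverts (T s) \<times> pverts (T s)) = parcs (T s)) \<and>
     (\<forall>s\<in>{1..t}. \<forall>s'\<in>{1..t}. s \<noteq> s' \<longrightarrow>
        (\<exists>!e. e \<in> parcs H \<and> e \<in> pverts (T s) \<times> pverts (T s')))"

definition odd_clique_expansion ::
    "nat \<Rightarrow> (nat \<Rightarrow> 'a pair_pre_digraph) \<Rightarrow> 'a pair_pre_digraph \<Rightarrow> bool" where
  "odd_clique_expansion t T H \<longleftrightarrow>
     clique_expansion t T H \<and>
     (\<exists>c :: 'a \<Rightarrow> nat. c ` pverts H \<subseteq> {1, 2} \<and>
        (\<forall>s\<in>{1..t}. \<forall>(u, v)\<in>parcs (T s). c u \<noteq> c v) \<and>
        (\<forall>s\<in>{1..t}. \<forall>s'\<in>{1..t}. s \<noteq> s' \<longrightarrow>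
           (\<forall>(u, v)\<in>parcs H. u \<in> pverts (T s) \<and> v \<in> pverts (T s') \<longrightarrow> c u = c v)))"

definition has_clique_minor :: "'a pair_pre_digraph \<Rightarrow> nat \<Rightarrow> bool" where
  "has_clique_minor G t \<longleftrightarrow>
     (\<exists>H T. subgraph (with_proj H) (with_proj G) \<and> clique_expansion t T H)"

definition has_odd_clique_minor :: "'a pair_pre_digraph \<Rightarrow> nat \<Rightarrow> bool" where
  "has_odd_clique_minor G t \<longleftrightarrow>
     (\<exists>H T. subgraph (with_proj H) (with_proj G) \<and> odd_clique_expansion t T H)"

definition proper_coloring :: "'a pair_pre_digraph \<Rightarrow> ('a \<Rightarrow> 'c) \<Rightarrow> bool" where
  "proper_coloring G c \<longleftrightarrow> (\<forall>(u, v)\<in>parcs G. c u \<noteq> c v)"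

text \<open>The number of colors is an arbitrary integer; no graph is \<open>k\<close>-colorable for \<open>k < 0\<close>.\<close>

definition colorable :: "'a pair_pre_digraph \<Rightarrow> int \<Rightarrow> bool" where
  "colorable G k \<longleftrightarrow>
     (\<exists>c :: 'a \<Rightarrow> nat. proper_coloring G c \<and> int (card (c ` pverts G)) \<le> k)"

end

theory Submission
  imports Defs "HOL-Library.Nat_Bijection"
begin

text \<open>
  Partition the vertices greedily into pieces, each being a maximal vertex set
  (among the vertices not used so far) that induces a connected bipartite subgraph, and 2-colour
  every piece properly. By maximality, a vertex outside a piece that has a neighbour in it has
  neighbours of both colours in it (otherwise it could be added). Hence between two adjacent pieces
  there are both a monochromatic and a bichromatic edge. Contracting the pieces gives a graph
  without a \<open>K\<^sub>t\<close> minor, as such a minor would lift to an odd one: the bichromatic edges connect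
  the pieces belonging to one branch set, so a spanning tree can be chosen among them, and
  monochromatic edges join different branch sets. Pairing an \<open>f(t)\<close>-colouring of the contracted
  graph with the 2-colouring of the pieces gives the result.
\<close>

section \<open>Pair graphs, connectivity and subgraphs in terms of relations\<close>

lemma pair_graph_iff:
  "pair_graph G \<longleftrightarrow>
     finite (pverts G) \<and> parcs G \<subseteq> pverts G \<times> pverts G \<and> sym (parcs G) \<and> irrefl (parcs G)"
proof
  assume "pair_graph G"
  then interpret pair_graph G .
  show "finite (pverts G) \<and> parcs G \<subseteq> pverts G \<times> pverts G \<and> sym (parcs G) \<and> irrefl (parcs G)"
    using pair_finite_verts arc_fst_in_verts arc_snd_in_verts arcs_symmetric no_loops'
    by (fastforce simp: sym_def irrefl_def)
next
  assume *: "finite (pverts G) \<and> parcs G \<subseteq> pverts G \<times> pverts G \<and> sym (parcs G) \<and> irrefl (parcs G)"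
  then have "finite (parcs G)"
    by (meson finite_SigmaI finite_subset)
  with * show "pair_graph G"
    by unfold_locales (auto simp: symmetric_def irrefl_def)
qed

text \<open>Symmetrising a symmetric arc set changes nothing, and arcs never leave the vertex set,
  so the reachability behind \<open>connected\<close> reduces to the plain reflexive transitive
  closure.\<close>

lemma connected_pair_graph_iff:
  assumes "pair_graph G"
  shows "connected (with_proj G) \<longleftrightarrow>
    pverts G \<noteq> {} \<and> (\<forall>u\<in>pverts G. \<forall>v\<in>pverts G. (u, v) \<in> (parcs G)\<^sup>*)"
proof -
  interpret pair_graph G by fact
  have sub: "parcs G \<subseteq> pverts G \<times> pverts G"
    using assms by (simp add: pair_graph_iff)
  have mk: "mk_symmetric (with_proj G) = G"
    using arcs_symmetric by (auto simp: mk_symmetric_def intro!: pair_pre_digraph.equality)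
  have "(u, v) \<in> rtrancl_on (pverts G) (parcs G) \<longleftrightarrow> (u, v) \<in> (parcs G)\<^sup>*"
    if "u \<in> pverts G" for u v
  proof
    assume "(u, v) \<in> (parcs G)\<^sup>*"
    then show "(u, v) \<in> rtrancl_on (pverts G) (parcs G)"
    proof induction
      case base
      then show ?case using that by auto
    next
      case (step y z)
      then show ?case using sub by (auto intro: rtrancl_on_into_rtrancl_on)
    qed
  qed (rule rtrancl_on_rtranclI)
  then show ?thesis
    by (auto simp: connected_def strongly_connected_def reachable_def mk)
qed

lemma subgraph_with_proj_iff:
  assumes "pair_graph H" "pair_graph G"
  shows "subgraph (with_proj H) (with_proj G) \<longleftrightarrow> pverts H \<subseteq> pverts G \<and> parcs H \<subseteq> parcs G"
proof -
  interpret H: pair_graph H by fact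
  interpret G: pair_graph G by fact
  show ?thesis
    using H.wf_digraph_axioms G.wf_digraph_axioms by (auto simp: subgraph_def)
qed

section \<open>Spanning trees by deletion of cycle edges\<close>

lemma pcas_fst:
  assumes "pcas u p v" "e \<in> set p"
  shows "fst e = u \<or> fst e \<in> snd ` set p"
  using assms by (induction u p v rule: pcas.induct) auto

lemma pcas_last:
  assumes "pcas u p v" "p \<noteq> []"
  shows "v \<in> snd ` set p"
  using assms
proof (induction u p v rule: pcas.induct)
  case (2 u e es v)
  then show ?case by (cases es) auto
qed simp

lemma pcas_rtrancl:
  assumes "pcas u p v" "set p \<subseteq> E"
  shows "(u, v) \<in> E\<^sup>*"
  using assms
proof (induction u p v rule: pcas.induct)
  case (2 u e es v)
  then have "(u, snd e) \<in> E" "(snd e, v) \<in> E\<^sup>*"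
    by (cases e; auto)+
  then show ?case by (rule converse_rtrancl_into_rtrancl)
qed simp

text \<open>The first edge of the cycle can be deleted in both directions, since the remaining arcs
  lead from its head back to its tail. Three arcs are needed: in a closed walk
  \<open>u, y, u\<close> the way back would be the deleted edge itself.\<close>

lemma cycle_arc_redundant:
  assumes "sym E" "set p \<subseteq> E" "pcas u p u" "distinct (map snd p)" "3 \<le> length p"
  shows "\<exists>x y. (x, y) \<in> E \<and> E \<subseteq> (E - {(x, y), (y, x)})\<^sup>*"
proof -
  from assms(5) obtain a b r where p: "p = a # b # r" and r: "r \<noteq> []"
    by (cases p; cases "tl p"; cases "tl (tl p)") auto
  define y where "y = snd a"
  have a: "a = (u, y)" and b: "fst b = y" and cas: "pcas (snd b) r u" and cas': "pcas y (b # r) u"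
    using assms(3) by (auto simp: p y_def prod_eq_iff)
  have y: "y \<notin> snd ` set (b # r)" and b': "snd b \<notin> snd ` set r"
    using assms(4) by (auto simp: p y_def)
  \<comment> \<open>The nonempty walk \<open>r\<close> ends in \<open>u\<close>, so \<open>u\<close>
    is already the head of an arc of \<open>r\<close>; distinct heads then exclude that
    \<open>b\<close> is the reversed arc \<open>(y, u)\<close>.\<close>
  have "snd b \<noteq> u"
    using pcas_last[OF cas r] b' by auto
  moreover have "(y, u) \<notin> set r"
    using pcas_fst[OF cas, of "(y, u)"] y by auto
  moreover have "(u, y) \<notin> set (b # r)"
    using y by force
  ultimately have "set (b # r) \<subseteq> E - {(u, y), (y, u)}"
    using assms(2) by (auto simp: p)
  then have yu: "(y, u) \<in> (E - {(u, y), (y, u)})\<^sup>*"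
    by (rule pcas_rtrancl[OF cas'])
  moreover have "sym (E - {(u, y), (y, u)})"
    using assms(1) by (auto simp: sym_def)
  ultimately have "(u, y) \<in> (E - {(u, y), (y, u)})\<^sup>*"
    by (metis sym_rtrancl symD)
  with yu have "E \<subseteq> (E - {(u, y), (y, u)})\<^sup>*"
    by auto
  moreover have "(u, y) \<in> E"
    using assms(2) by (auto simp: p a)
  ultimately show ?thesis by blast
qed

text \<open>An inclusion-minimal symmetric subset of \<open>E\<close> that still connects
  \<open>V\<close> is a tree: a cycle would contain an edge whose removal preserves
  connectivity.\<close>

lemma ex_spanning_undirected_tree:
  assumes "finite V" "V \<noteq> {}" "E \<subseteq> V \<times> V" "sym E" "irrefl E"
    and "\<And>u v. u \<in> V \<Longrightarrow> v \<in> V \<Longrightarrow> (u, v) \<in> E\<^sup>*"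
  shows "\<exists>F\<subseteq>E. undirected_tree \<lparr>pverts = V, parcs = F\<rparr>"
proof -
  define \<F> where "\<F> = {F. F \<subseteq> E \<and> sym F \<and> (\<forall>u\<in>V. \<forall>v\<in>V. (u, v) \<in> F\<^sup>*)}"
  have "finite E"
    using assms(1,3) by (meson finite_SigmaI finite_subset)
  then have "finite \<F>"
    by (auto simp: \<F>_def intro: finite_subset[of _ "Pow E"])
  moreover have "E \<in> \<F>"
    using assms by (auto simp: \<F>_def)
  ultimately obtain F where F: "F \<in> \<F>" and min: "\<And>F'. F' \<in> \<F> \<Longrightarrow> F' \<subseteq> F \<Longrightarrow> F' = F"
    using finite_has_minimal[of \<F>] by blast
  let ?T = "\<lparr>pverts = V, parcs = F\<rparr>"
  have T: "pair_graph ?T"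
    using F assms by (auto simp: pair_graph_iff \<F>_def irrefl_def)
  then interpret T: pair_graph ?T .
  have "\<not> (T.cycle q \<and> 3 \<le> length q)" for q
  proof
    assume q: "T.cycle q \<and> 3 \<le> length q"
    then obtain u where u: "T.awalk u q u" "distinct (tl (pawalk_verts u q))" "q \<noteq> []"
      by (auto simp: T.cycle_def)
    then have cas: "pcas u q u" and "set q \<subseteq> F"
      by (auto simp: T.awalk_def)
    \<comment> \<open>The vertex sequence of a walk without its first entry is the list of heads of
      its arcs.\<close>
    moreover have "distinct (map snd q)"
      using T.awalk_verts_conv'[of u q u] cas u by simp
    moreover have "sym F"
      using F by (simp add: \<F>_def)
    ultimately obtain x y where xy: "(x, y) \<in> F" and F': "F \<subseteq> (F - {(x, y), (y, x)})\<^sup>*"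
      using cycle_arc_redundant[of F q u] q by auto
    have "F\<^sup>* \<subseteq> (F - {(x, y), (y, x)})\<^sup>*"
      using F' by (rule rtrancl_subset_rtrancl)
    then have "F - {(x, y), (y, x)} \<in> \<F>"
      using F by (auto simp: \<F>_def sym_def)
    from min[OF this] xy show False by auto
  qed
  then have "undirected_tree ?T"
    using T F assms(2) by (auto simp: undirected_tree_def connected_pair_graph_iff \<F>_def)
  then show ?thesis
    using F by (auto simp: \<F>_def)
qed

section \<open>Decomposition into maximal connected bipartite pieces\<close>

definition connected_bipartite :: "'a rel \<Rightarrow> 'a set \<Rightarrow> ('a \<Rightarrow> bool) \<Rightarrow> bool" where
  "connected_bipartite E X c \<longleftrightarrow> X \<noteq> {} \<and>
     (\<forall>(u, v)\<in>E \<inter> X \<times> X. c u \<noteq> c v) \<and> (\<forall>u\<in>X. \<forall>v\<in>X. (u, v) \<in> (E \<inter> X \<times> X)\<^sup>*)"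

text \<open>All neighbours of \<open>v\<close> in \<open>X\<close> share the colour
  \<open>b\<close>, so \<open>v\<close> may take the other one; the neighbour \<open>x\<close>
  attaches \<open>v\<close> to the connected set. This is the extension that maximality of a piece
  forbids.\<close>

lemma connected_bipartite_insert:
  assumes X: "connected_bipartite E X c" and "sym E" "irrefl E" "v \<notin> X" "x \<in> X" "(x, v) \<in> E"
    and c: "\<And>x. x \<in> X \<Longrightarrow> (x, v) \<in> E \<Longrightarrow> c x = b"
  shows "connected_bipartite E (insert v X) (c(v := \<not> b))"
proof -
  let ?X = "insert v X"
  let ?R = "(E \<inter> ?X \<times> ?X)\<^sup>*"
  have E: "(v, x) \<in> E"
    using assms(2,6) by (auto dest: symD)
  have "(y, z) \<in> ?R" if "y \<in> X" "z \<in> X" for y z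
  proof -
    have "(y, z) \<in> (E \<inter> X \<times> X)\<^sup>*"
      using X that by (auto simp: connected_bipartite_def)
    then show ?thesis by (rule set_mp[OF rtrancl_mono, rotated]) auto
  qed
  moreover have "(x, v) \<in> ?R" "(v, x) \<in> ?R"
    using assms(5,6) E by auto
  ultimately have "(y, z) \<in> ?R" if "y \<in> ?X" "z \<in> ?X" for y z
    using that \<open>x \<in> X\<close> by (metis insertE rtrancl.rtrancl_refl rtrancl_trans)
  moreover have "(c(v := \<not> b)) y \<noteq> (c(v := \<not> b)) z" if "(y, z) \<in> E" "y \<in> ?X" "z \<in> ?X" for y z
  proof -
    have "(z, y) \<in> E" "y \<noteq> z"
      using that assms(2,3) by (auto dest: symD simp: irrefl_def)
    moreover have "c y \<noteq> c z" if "y \<in> X" "z \<in> X"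
      using X that \<open>(y, z) \<in> E\<close> by (auto simp: connected_bipartite_def)
    ultimately show ?thesis
      using that c by auto
  qed
  ultimately show ?thesis
    unfolding connected_bipartite_def by blast
qed

text \<open>The pieces are the fibres of \<open>p\<close> on \<open>V\<close>. Maximality is
  recorded only through its consequence in the last clause: \<open>b = True\<close> yields a
  monochromatic and \<open>b = False\<close> a bichromatic edge between adjacent pieces. Natural
  numbers as labels make the contracted graph a graph on \<open>nat\<close>.\<close>

definition bipartite_decomposition ::
    "'a set \<Rightarrow> 'a rel \<Rightarrow> ('a \<Rightarrow> nat) \<Rightarrow> ('a \<Rightarrow> bool) \<Rightarrow> bool" where
  "bipartite_decomposition V E p c \<longleftrightarrow>
     (\<forall>u\<in>V. \<forall>v\<in>V. p u = p v \<longrightarrow> (u, v) \<in> {(x, y)\<in>E. x \<in> V \<and> y \<in> V \<and> p x = p y}\<^sup>*) \<and>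
     (\<forall>u\<in>V. \<forall>v\<in>V. (u, v) \<in> E \<longrightarrow> p u = p v \<longrightarrow> c u \<noteq> c v) \<and>
     (\<forall>u\<in>V. \<forall>v\<in>V. (u, v) \<in> E \<longrightarrow> p u \<noteq> p v \<longrightarrow>
       (\<forall>b. \<exists>x\<in>V. \<exists>y\<in>V. (x, y) \<in> E \<and> p x = p u \<and> p y = p v \<and> (c x = c y \<longleftrightarrow> b)))"

lemma bipartite_decompositionD:
  assumes "bipartite_decomposition V E p c" "u \<in> V" "v \<in> V"
  shows "p u = p v \<Longrightarrow> (u, v) \<in> {(x, y)\<in>E. x \<in> V \<and> y \<in> V \<and> p x = p y}\<^sup>*"
    and "(u, v) \<in> E \<Longrightarrow> p u = p v \<Longrightarrow> c u \<noteq> c v"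
    and "(u, v) \<in> E \<Longrightarrow> p u \<noteq> p v \<Longrightarrow>
      \<exists>x\<in>V. \<exists>y\<in>V. (x, y) \<in> E \<and> p x = p u \<and> p y = p v \<and> (c x = c y \<longleftrightarrow> b)"
  using assms by (simp_all add: bipartite_decomposition_def)

text \<open>A maximal piece \<open>X\<close> of \<open>V\<close> is split off and the induction
  hypothesis handles \<open>V - X\<close>. An edge between \<open>X\<close> and a later piece has an
  end in \<open>V - X\<close>, where maximality of \<open>X\<close> within \<open>V\<close>
  applies.\<close>

lemma ex_bipartite_decomposition:
  assumes "finite V" "sym E" "irrefl E"
  shows "\<exists>p c. bipartite_decomposition V E p c"
  using assms(1)
proof (induction V rule: finite_psubset_induct)
  case (psubset V)
  show ?case
  proof (cases "V = {}")
    case True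
    then show ?thesis by (simp add: bipartite_decomposition_def)
  next
    case False
    define \<X> where "\<X> = {X. X \<subseteq> V \<and> (\<exists>c. connected_bipartite E X c)}"
    obtain v0 where "v0 \<in> V"
      using False by blast
    then have "{v0} \<in> \<X>"
      using assms(3) by (auto simp: \<X>_def connected_bipartite_def irrefl_def)
    moreover have "finite \<X>"
      using psubset(1) by (auto simp: \<X>_def intro: finite_subset[of _ "Pow V"])
    ultimately obtain X where "X \<in> \<X>" and max: "\<And>Y. Y \<in> \<X> \<Longrightarrow> X \<subseteq> Y \<Longrightarrow> X = Y"
      using finite_has_maximal[of \<X>] by blast
    then obtain c0 where XV: "X \<subseteq> V" and X: "connected_bipartite E X c0"
      by (auto simp: \<X>_def)
    \<comment> \<open>If no neighbour of \<open>v\<close> in \<open>X\<close> had colour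
      \<open>b\<close>, all of them would have colour \<open>\<not> b\<close>, and \<open>X\<close>
      could be enlarged by \<open>v\<close>.\<close>
    have both: "\<exists>y\<in>X. (y, v) \<in> E \<and> c0 y = b" if "x \<in> X" "v \<in> V - X" "(x, v) \<in> E" for x v b
    proof (rule ccontr)
      assume "\<not> ?thesis"
      then have "connected_bipartite E (insert v X) (c0(v := \<not> (\<not> b)))"
        using that by (intro connected_bipartite_insert[OF X assms(2,3) _ that(1,3)]) auto
      then have "insert v X \<in> \<X>"
        using that XV by (auto simp: \<X>_def)
      with max that show False by blast
    qed
    have "V - X \<subset> V"
      using X XV by (auto simp: connected_bipartite_def)
    then obtain p' c' where IH: "bipartite_decomposition (V - X) E p' c'"
      using psubset.IH by blast
    \<comment> \<open>A fresh label keeps \<open>X\<close> apart from all pieces of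
      \<open>V - X\<close>.\<close>
    obtain k where k: "k \<notin> p' ` V"
      using psubset(1) by (metis ex_new_if_finite finite_imageI infinite_UNIV_nat)
    define p where "p = (\<lambda>v. if v \<in> X then k else p' v)"
    define c where "c = (\<lambda>v. if v \<in> X then c0 v else c' v)"
    have p: "p u = p v \<longleftrightarrow> (if u \<in> X then v \<in> X else v \<notin> X \<and> p' u = p' v)"
      if "u \<in> V" "v \<in> V" for u v
      using k that by (auto simp: p_def)
    let ?D = "{(x, y)\<in>E. x \<in> V \<and> y \<in> V \<and> p x = p y}"
    have "(u, v) \<in> ?D\<^sup>*" if "u \<in> V" "v \<in> V" "p u = p v" for u v
    proof (cases "u \<in> X")
      case True
      then have "(u, v) \<in> (E \<inter> X \<times> X)\<^sup>*"
        using X that p by (auto simp: connected_bipartite_def)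
      moreover have "E \<inter> X \<times> X \<subseteq> ?D"
        using XV by (auto simp: p_def)
      ultimately show ?thesis
        using rtrancl_mono by blast
    next
      case False
      then have "(u, v) \<in> {(x, y)\<in>E. x \<in> V - X \<and> y \<in> V - X \<and> p' x = p' y}\<^sup>*"
        using that p[of u v] by (intro bipartite_decompositionD(1)[OF IH]) auto
      moreover have "{(x, y)\<in>E. x \<in> V - X \<and> y \<in> V - X \<and> p' x = p' y} \<subseteq> ?D"
        by (auto simp: p_def)
      ultimately show ?thesis
        using rtrancl_mono by blast
    qed
    moreover have "c u \<noteq> c v" if "u \<in> V" "v \<in> V" "(u, v) \<in> E" "p u = p v" for u v
    proof (cases "u \<in> X")
      case True
      then show ?thesis
        using that X p[of u v] by (auto simp: c_def connected_bipartite_def)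
    next
      case False
      then show ?thesis
        using that p[of u v] bipartite_decompositionD(2)[OF IH, of u v] by (simp add: c_def)
    qed
    moreover have "\<exists>x\<in>V. \<exists>y\<in>V. (x, y) \<in> E \<and> p x = p u \<and> p y = p v \<and> (c x = c y \<longleftrightarrow> b)"
      if uv: "u \<in> V" "v \<in> V" "(u, v) \<in> E" "p u \<noteq> p v" for u v b
    proof -
      consider "u \<in> X" "v \<notin> X" | "u \<notin> X" "v \<in> X" | "u \<notin> X" "v \<notin> X" "p' u \<noteq> p' v"
        using uv p by (auto split: if_splits)
      then show ?thesis
      proof cases
        case 1
        \<comment> \<open>The Boolean \<open>c v = b\<close> is the colour of \<open>v\<close> if
          \<open>b\<close> holds and the opposite colour otherwise, so this one choice covers both
          kinds of edge.\<close>
        then obtain y where "y \<in> X" "(y, v) \<in> E" "c0 y = (c v = b)"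
          using both[of u v "c v = b"] uv by blast
        then show ?thesis
          using 1 uv XV by (intro bexI[of _ y] bexI[of _ v]) (auto simp: p_def c_def)
      next
        case 2
        then obtain y where "y \<in> X" "(y, u) \<in> E" "c0 y = (c u = b)"
          using both[of v u "c u = b"] uv assms(2) by (auto dest: symD)
        then show ?thesis
          using 2 uv XV assms(2)
          by (intro bexI[of _ u] bexI[of _ y]) (auto simp: p_def c_def dest: symD)
      next
        case 3
        then obtain x y where "x \<in> V - X" "y \<in> V - X" "(x, y) \<in> E"
            "p' x = p' u" "p' y = p' v" "c' x = c' y \<longleftrightarrow> b"
          using bipartite_decompositionD(3)[OF IH, of u v b] uv by blast
        then show ?thesis
          using 3 by (intro bexI[of _ x] bexI[of _ y]) (auto simp: p_def c_def)
      qed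
    qed
    ultimately have "bipartite_decomposition V E p c"
      unfolding bipartite_decomposition_def by blast
    then show ?thesis by blast
  qed
qed

section \<open>Contracting the pieces and lifting clique minors\<close>

definition contraction :: "'a pair_pre_digraph \<Rightarrow> ('a \<Rightarrow> 'b) \<Rightarrow> 'b pair_pre_digraph" where
  "contraction G p =
     \<lparr>pverts = p ` pverts G, parcs = {(p u, p v) | u v. (u, v) \<in> parcs G \<and> p u \<noteq> p v}\<rparr>"

lemma pair_graph_contraction:
  assumes "pair_graph G"
  shows "pair_graph (contraction G p)"
  using assms by (fastforce simp: pair_graph_iff contraction_def sym_def irrefl_def)

lemma contraction_arcE:
  assumes "(i, j) \<in> parcs (contraction G p)"
  obtains u v where "(u, v) \<in> parcs G" "p u = i" "p v = j" "i \<noteq> j"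
  using assms by (auto simp: contraction_def)

text \<open>A walk in \<open>T\<close> is lifted to \<open>G\<close>: inside a piece one moves along
  its edges, all bichromatic because \<open>c\<close> is proper there, and each arc of
  \<open>T\<close> is replaced by a bichromatic edge between the two pieces.\<close>

lemma bichromatic_connected:
  assumes dec: "bipartite_decomposition (pverts G) (parcs G) p c"
    and G: "pair_graph G" and T: "connected (with_proj T)" "pair_graph T"
    and sub: "parcs T \<subseteq> parcs (contraction G p)"
    and u: "u \<in> pverts G" "p u \<in> pverts T" and v: "v \<in> pverts G" "p v \<in> pverts T"
  shows "(u, v) \<in> {(x, y)\<in>parcs G. p x \<in> pverts T \<and> p y \<in> pverts T \<and> c x \<noteq> c y}\<^sup>*"
    (is "_ \<in> ?R\<^sup>*")
proof -
  let ?V = "pverts G" and ?E = "parcs G"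
  have piece: "(x, y) \<in> ?R\<^sup>*" if "x \<in> ?V" "y \<in> ?V" "p x = p y" "p x \<in> pverts T" for x y
  proof -
    have "(x, y) \<in> {(x, y)\<in>?E. x \<in> ?V \<and> y \<in> ?V \<and> p x = p y}\<^sup>*"
      using bipartite_decompositionD(1)[OF dec] that by blast
    then have "(x, y) \<in> ?R\<^sup>* \<and> p y \<in> pverts T"
    proof induction
      case base
      then show ?case using that by simp
    next
      case (step y z)
      then have yz: "(y, z) \<in> ?R"
        using bipartite_decompositionD(2)[OF dec] by auto
      then have "(x, z) \<in> ?R\<^sup>*"
        using step.IH by (meson rtrancl.rtrancl_into_rtrancl)
      moreover have "p z \<in> pverts T"
        using yz by simp
      ultimately show ?case ..
    qed
    then show ?thesis ..
  qed
  have arc: "\<exists>x\<in>?V. \<exists>y\<in>?V. (x, y) \<in> ?R \<and> p x = i \<and> p y = j" if ij: "(i, j) \<in> parcs T" for i j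
  proof -
    have "(i, j) \<in> parcs (contraction G p)"
      using ij sub by blast
    then have "\<exists>x\<in>?V. \<exists>y\<in>?V. (x, y) \<in> ?E \<and> p x = i \<and> p y = j \<and> p x \<noteq> p y"
      using G by (elim contraction_arcE) (auto simp: pair_graph_iff)
    then obtain x y where "x \<in> ?V" "y \<in> ?V" "(x, y) \<in> ?E" "p x = i" "p y = j" "c x \<noteq> c y"
      using bipartite_decompositionD(3)[OF dec, where b = False] by blast
    moreover have "i \<in> pverts T" "j \<in> pverts T"
      using T ij by (auto simp: pair_graph_iff)
    ultimately show ?thesis by blast
  qed
  \<comment> \<open>The induction along the walk in \<open>T\<close> needs every vertex
    \<open>w\<close> of the piece \<open>i\<close>, because the next lifted arc may leave that piece
    at any of its vertices.\<close>
  have "w \<in> ?V \<Longrightarrow> p w = i \<Longrightarrow> (u, w) \<in> ?R\<^sup>*" if "(p u, i) \<in> (parcs T)\<^sup>*" for w i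
    using that
  proof (induction arbitrary: w rule: rtrancl_induct)
    case base
    then show ?case using piece[of u w] u by simp
  next
    case (step i j)
    then obtain x y where xy: "x \<in> ?V" "y \<in> ?V" "(x, y) \<in> ?R" "p x = i" "p y = j"
      using arc by blast
    have "(u, x) \<in> ?R\<^sup>*"
      using step.IH xy by simp
    also have "(x, y) \<in> ?R\<^sup>*"
      using xy(3) by (rule r_into_rtrancl)
    also have "(y, w) \<in> ?R\<^sup>*"
      using piece[of y w] xy step.prems by simp
    finally show ?case .
  qed
  moreover have "(p u, p v) \<in> (parcs T)\<^sup>*"
    using T u v by (simp add: connected_pair_graph_iff)
  ultimately show ?thesis
    using v(1) by simp
qed

text \<open>Each tree \<open>T s\<close> is replaced by a spanning tree of bichromatic edges on the
  union \<open>X s\<close> of its pieces, and each connecting edge by a monochromatic edge of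
  \<open>G\<close>. The colouring \<open>c\<close> then certifies oddness.\<close>

lemma has_odd_clique_minor_if_contraction:
  assumes G: "pair_graph G" and dec: "bipartite_decomposition (pverts G) (parcs G) p c"
    and minor: "has_clique_minor (contraction G p) t"
  shows "has_odd_clique_minor G t"
proof -
  let ?V = "pverts G" and ?E = "parcs G"
  have V: "finite ?V" and E: "?E \<subseteq> ?V \<times> ?V" "sym ?E" "irrefl ?E"
    using G by (auto simp: pair_graph_iff)
  obtain H T where sub: "subgraph (with_proj H) (with_proj (contraction G p))"
    and HT: "clique_expansion t T H"
    using minor by (auto simp: has_clique_minor_def)
  have "pair_graph H"
    using HT by (simp add: clique_expansion_def)
  then have "pverts H \<subseteq> pverts (contraction G p) \<and> parcs H \<subseteq> parcs (contraction G p)"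
    using sub subgraph_with_proj_iff pair_graph_contraction[OF G] by blast
  then have HV: "pverts H \<subseteq> p ` ?V" and H: "parcs H \<subseteq> parcs (contraction G p)"
    by (simp_all add: contraction_def)
  have T: "pair_graph (T s)" "connected (with_proj (T s))"
      "pverts (T s) \<subseteq> p ` ?V" "parcs (T s) \<subseteq> parcs (contraction G p)" if s: "s \<in> {1..t}" for s
  proof -
    have "undirected_tree (T s)"
      using HT s by (simp add: clique_expansion_def)
    then show "pair_graph (T s)" "connected (with_proj (T s))"
      by (simp_all add: undirected_tree_def)
    have "pverts (T s) \<subseteq> pverts H"
      using HT s by (auto simp: clique_expansion_def)
    then show "pverts (T s) \<subseteq> p ` ?V"
      using HV by blast
    have "parcs H \<inter> (pverts (T s) \<times> pverts (T s)) = parcs (T s)"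
      using HT s by (simp add: clique_expansion_def)
    then show "parcs (T s) \<subseteq> parcs (contraction G p)"
      using H by blast
  qed
  have disj: "pverts (T s) \<inter> pverts (T s') = {}" if "s \<in> {1..t}" "s' \<in> {1..t}" "s \<noteq> s'" for s s'
    using HT that by (auto simp: clique_expansion_def)

  define X where "X s = {v \<in>?V. p v \<in> pverts (T s)}" for s
  have X_eq: "s = s'" if "v \<in> X s" "v \<in> X s'" "s \<in> {1..t}" "s' \<in> {1..t}" for v s s'
    using disj[of s s'] that by (auto simp: X_def)
  \<comment> \<open>Spanning trees chosen inside \<open>R s\<close> satisfy the colour condition on
    trees automatically.\<close>
  define R where
    "R s = {(x, y) \<in> ?E. p x \<in> pverts (T s) \<and> p y \<in> pverts (T s) \<and> c x \<noteq> c y}" for s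
  have "\<exists>F\<subseteq>R s. undirected_tree \<lparr>pverts = X s, parcs = F\<rparr>" if s: "s \<in> {1..t}" for s
  proof (rule ex_spanning_undirected_tree)
    show "finite (X s)" "R s \<subseteq> X s \<times> X s" "sym (R s)" "irrefl (R s)"
      using V E by (auto simp: X_def R_def sym_def irrefl_def)
    show "X s \<noteq> {}"
      using T[OF s] by (auto simp: X_def connected_pair_graph_iff)
    show "(u, v) \<in> (R s)\<^sup>*" if "u \<in> X s" "v \<in> X s" for u v
      unfolding R_def using that T[OF s] E
      by (intro bichromatic_connected[OF dec]) (auto simp: X_def G)
  qed
  then obtain F where F: "\<And>s. s \<in> {1..t} \<Longrightarrow> F s \<subseteq> R s"
      "\<And>s. s \<in> {1..t} \<Longrightarrow> undirected_tree \<lparr>pverts = X s, parcs = F s\<rparr>"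
    by metis
  have F_pair: "pair_graph \<lparr>pverts = X s, parcs = F s\<rparr>" if "s \<in> {1..t}" for s
    using F(2)[OF that] by (simp add: undirected_tree_def)
  then have FX: "F s \<subseteq> X s \<times> X s" "sym (F s)" if "s \<in> {1..t}" for s
    using that by (auto simp: pair_graph_iff)

  have "\<exists>e. e \<in> ?E \<and> e \<in> X s \<times> X s' \<and> c (fst e) = c (snd e)"
    if s: "s \<in> {1..t}" "s' \<in> {1..t}" "s \<noteq> s'" for s s'
  proof -
    have "\<exists>!a. a \<in> parcs H \<and> a \<in> pverts (T s) \<times> pverts (T s')"
      using HT s by (simp add: clique_expansion_def)
    then obtain i j where "(i, j) \<in> parcs (contraction G p)"
        and ij: "i \<in> pverts (T s)" "j \<in> pverts (T s')"
      using H by blast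
    then have "\<exists>x\<in>?V. \<exists>y\<in>?V. (x, y) \<in> ?E \<and> p x = i \<and> p y = j \<and> p x \<noteq> p y"
      using E(1) by (elim contraction_arcE) auto
    then obtain x y where "x \<in> ?V" "y \<in> ?V" "(x, y) \<in> ?E" "p x = i" "p y = j" "c x = c y"
      using bipartite_decompositionD(3)[OF dec, where b = True] by blast
    then show ?thesis
      using ij by (intro exI[of _ "(x, y)"]) (auto simp: X_def)
  qed
  then obtain e where e: "\<And>s s'. s \<in> {1..t} \<Longrightarrow> s' \<in> {1..t} \<Longrightarrow> s \<noteq> s' \<Longrightarrow>
      e s s' \<in> ?E \<and> e s s' \<in> X s \<times> X s' \<and> c (fst (e s s')) = c (snd (e s s'))"
    by metis
  \<comment> \<open>The independent choices \<open>e s s'\<close> and \<open>e s' s\<close> may be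
    different edges. Keeping the one with the smaller index first and reversing it for the other
    order leaves a single undirected edge per pair.\<close>
  define m where "m s s' = (if s < s' then e s s' else prod.swap (e s' s))" for s s'
  have m: "m s s' \<in> ?E" "m s s' \<in> X s \<times> X s'" "c (fst (m s s')) = c (snd (m s s'))"
    if "s \<in> {1..t}" "s' \<in> {1..t}" "s \<noteq> s'" for s s'
    using e[of s s'] e[of s' s] that E(2) by (auto simp: m_def prod.swap_def sym_def)
  have m_swap: "m s' s = prod.swap (m s s')" if "s \<noteq> s'" for s s'
    using that by (auto simp: m_def)

  define M where "M = {m s s' | s s'. s \<in> {1..t} \<and> s' \<in> {1..t} \<and> s \<noteq> s'}"
  have M_sym: "sym M"
  proof (rule symI)
    fix x y
    assume "(x, y) \<in> M"
    then obtain s s' where "(x, y) = m s s'" "s \<in> {1..t}" "s' \<in> {1..t}" "s \<noteq> s'"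
      by (auto simp: M_def)
    then show "(y, x) \<in> M"
      using m_swap[of s s'] unfolding M_def by (metis (mono_tags, lifting) mem_Collect_eq swap_simp)
  qed
  \<comment> \<open>Only tree arcs and chosen connecting arcs are kept: \<open>G\<close> may have
    further arcs inside \<open>X s\<close> or between two such sets, which an expansion does not
    allow.\<close>
  define K where "K = \<lparr>pverts = \<Union>s\<in>{1..t}. X s, parcs = (\<Union>s\<in>{1..t}. F s) \<union> M\<rparr>"
  have KE: "parcs K \<subseteq> ?E"
    using F(1) m(1) by (fastforce simp: K_def M_def R_def)
  \<comment> \<open>Since the sets \<open>X s\<close> are disjoint, the ends of an arc determine the
    indices; this separates tree arcs from connecting arcs.\<close>
  have F_mem: "s = r \<and> s' = r" if "a \<in> F r" "a \<in> X s \<times> X s'"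
      "r \<in> {1..t}" "s \<in> {1..t}" "s' \<in> {1..t}" for a r s s'
    using that FX(1)[of r] X_eq by blast
  have m_mem: "s = r \<and> s' = r'" if "m r r' \<in> X s \<times> X s'"
      "r \<in> {1..t}" "r' \<in> {1..t}" "r \<noteq> r'" "s \<in> {1..t}" "s' \<in> {1..t}" for r r' s s'
    using that m(2)[of r r'] X_eq by (metis mem_Times_iff)
  have K_cases: "(\<exists>r\<in>{1..t}. a \<in> F r) \<or>
      (\<exists>r\<in>{1..t}. \<exists>r'\<in>{1..t}. r \<noteq> r' \<and> a = m r r')" if "a \<in> parcs K" for a
  proof -
    have "a \<in> (\<Union>s\<in>{1..t}. F s) \<union> M"
      using that by (simp add: K_def)
    then show ?thesis
      unfolding M_def by blast
  qed
  have K_inside: "parcs K \<inter> X s \<times> X s = F s" if s: "s \<in> {1..t}" for s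
  proof (intro subset_antisym subsetI)
    fix a assume a: "a \<in> parcs K \<inter> X s \<times> X s"
    then show "a \<in> F s"
      using K_cases[of a] F_mem m_mem s by (metis IntE)
  next
    fix a assume "a \<in> F s"
    then show "a \<in> parcs K \<inter> X s \<times> X s"
      using FX(1)[OF s] s by (auto simp: K_def)
  qed
  have K_between: "a \<in> parcs K \<and> a \<in> X s \<times> X s' \<longleftrightarrow> a = m s s'"
    if s: "s \<in> {1..t}" "s' \<in> {1..t}" "s \<noteq> s'" for a s s'
  proof
    assume "a \<in> parcs K \<and> a \<in> X s \<times> X s'"
    then show "a = m s s'"
      using K_cases[of a] F_mem m_mem s by metis
  next
    assume "a = m s s'"
    moreover have "m s s' \<in> M"
      using s unfolding M_def by blast
    then have "m s s' \<in> parcs K"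
      by (simp add: K_def)
    ultimately show "a \<in> parcs K \<and> a \<in> X s \<times> X s'"
      using m(2)[OF s] by simp
  qed
  have "pair_graph K"
  proof -
    have "sym ((\<Union>s\<in>{1..t}. F s) \<union> M)"
      using FX(2) M_sym by (intro sym_Un sym_UNION) blast+
    then have "sym (parcs K)"
      by (simp add: K_def)
    moreover have "parcs K \<subseteq> pverts K \<times> pverts K"
      using FX(1) m(2) by (fastforce simp: K_def M_def)
    moreover have "finite (pverts K)"
      using V by (auto simp: K_def X_def)
    ultimately show ?thesis
      using KE E(3) by (auto simp: pair_graph_iff irrefl_def)
  qed
  define T' where "T' s = \<lparr>pverts = X s, parcs = F s\<rparr>" for s
  have "clique_expansion t T' K"
    unfolding clique_expansion_def
  proof (intro conjI ballI impI)
    show "pair_graph K" by fact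
    show "pverts K = (\<Union>s\<in>{1..t}. pverts (T' s))"
      by (simp add: K_def T'_def)
  next
    fix s assume s: "s \<in> {1..t}"
    show "undirected_tree (T' s)"
      using F(2)[OF s] by (simp add: T'_def)
    show "parcs K \<inter> pverts (T' s) \<times> pverts (T' s) = parcs (T' s)"
      using K_inside[OF s] by (simp add: T'_def)
  next
    fix s s' assume s: "s \<in> {1..t}" "s' \<in> {1..t}" "s \<noteq> s'"
    show "pverts (T' s) \<inter> pverts (T' s') = {}"
      using X_eq s by (auto simp: T'_def)
    show "\<exists>!a. a \<in> parcs K \<and> a \<in> pverts (T' s) \<times> pverts (T' s')"
      using K_between[OF s] by (simp add: T'_def)
  qed
  moreover have "c u \<noteq> c v" if "s \<in> {1..t}" "(u, v) \<in> parcs (T' s)" for s u v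
    using F(1) that by (auto simp: T'_def R_def)
  moreover have "c u = c v" if "s \<in> {1..t}" "s' \<in> {1..t}" "s \<noteq> s'" "(u, v) \<in> parcs K"
      "u \<in> pverts (T' s)" "v \<in> pverts (T' s')" for s s' u v
    using K_between[of s s' "(u, v)"] m(3)[of s s'] that by (simp add: T'_def) (metis fst_conv snd_conv)
  ultimately have "odd_clique_expansion t T' K"
    unfolding odd_clique_expansion_def
    by (intro conjI exI[of _ "\<lambda>v. if c v then 1 else 2"]) auto
  moreover have "subgraph (with_proj K) (with_proj G)"
    using KE G \<open>pair_graph K\<close> by (auto simp: subgraph_with_proj_iff K_def X_def)
  ultimately show ?thesis
    by (auto simp: has_odd_clique_minor_def)
qed

section \<open>Colouring the original graph\<close>

text \<open>The pair of the piece's colour and the colour \<open>c\<close> is proper: the second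
  component separates adjacent vertices of one piece, the first those of different pieces.\<close>

lemma colorable_if_contraction:
  assumes G: "pair_graph G" and dec: "bipartite_decomposition (pverts G) (parcs G) p c"
    and col: "colorable (contraction G p) k"
  shows "colorable G (2 * k)"
proof -
  obtain h :: "nat \<Rightarrow> nat" where h: "proper_coloring (contraction G p) h"
    and k: "int (card (h ` p ` pverts G)) \<le> k"
    using col by (auto simp: colorable_def contraction_def)
  \<comment> \<open>Pairs are encoded as naturals because \<open>colorable\<close> asks for colours
    in \<open>nat\<close>.\<close>
  define g where "g v = prod_encode (h (p v), of_bool (c v))" for v
  have "g u \<noteq> g v" if "(u, v) \<in> parcs G" for u v
  proof (cases "p u = p v")
    case True
    then have "c u \<noteq> c v"
      using dec that G by (auto simp: bipartite_decomposition_def pair_graph_iff)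
    then show ?thesis by (simp add: g_def)
  next
    case False
    then have "h (p u) \<noteq> h (p v)"
      using h that by (fastforce simp: proper_coloring_def contraction_def)
    then show ?thesis by (simp add: g_def)
  qed
  then have "proper_coloring G g"
    by (auto simp: proper_coloring_def)
  moreover have "card (g ` pverts G) \<le> 2 * card (h ` p ` pverts G)"
  proof -
    let ?S = "(h ` p ` pverts G) \<times> {0, 1 :: nat}"
    have "finite ?S"
      using G by (auto simp: pair_graph_iff)
    moreover have "g ` pverts G \<subseteq> prod_encode ` ?S"
      by (auto simp: g_def)
    ultimately have "card (g ` pverts G) \<le> card ?S"
      by (rule surj_card_le)
    then show ?thesis
      by (simp add: card_cartesian_product)
  qed
  ultimately show ?thesis
    using k unfolding colorable_def by (intro exI[of _ g]) linarith
qed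

theorem theorem2:
  fixes t :: nat and f :: "nat \<Rightarrow> int" and G :: "'a pair_pre_digraph"
  assumes "\<And>H :: nat pair_pre_digraph.
             pair_graph H \<Longrightarrow> \<not> has_clique_minor H t \<Longrightarrow> colorable H (f t)"
    and "pair_graph G"
    and "\<not> has_odd_clique_minor G t"
  shows "colorable G (2 * f t)"
proof -
  obtain p c where dec: "bipartite_decomposition (pverts G) (parcs G) p c"
    using ex_bipartite_decomposition assms(2) by (metis pair_graph_iff)
  then have "\<not> has_clique_minor (contraction G p) t"
    using has_odd_clique_minor_if_contraction assms(2,3) by blast
  \<comment> \<open>The contraction has vertices in \<open>nat\<close>, whatever the vertex type of
    \<open>G\<close>, so the hypothesis on graphs over \<open>nat\<close> applies.\<close>
  then have "colorable (contraction G p) (f t)"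
    using assms(1,2) pair_graph_contraction by blast
  then show ?thesis
    using colorable_if_contraction assms(2) dec by blast
qed

end
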